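(* Let $K\ge 2$ be an integer. Every symmetric ex-p-merging function $F:[0,1]^K\to[0,1]$ is a p-merging function. Consequently, if an ex-p-merging function $F$ strictly dominates an admissible p-merging function $G$, then $F$ is not symmetric.
   Context: Fix an atomless probability space $(\Omega,\mathcal F,\mathbb P)$ (one supporting a random variable uniform on $[0,1]$); $\mathcal U^K$ is the set of all $K$-dimensional random vectors, with arbitrary joint distribution, whose components are each uniform on $[0,1]$. "Increasing" means non-decreasing in each component. A random vector is exchangeable if its distribution is invariant under every permutation of its components. A p-merging function is an increasing Borel function $F:[0,1]^K\to[0,1]$ such that $\mathbb P(F(\mathbf P)\le\alpha)\le\alpha$ for all $\alpha\in(0,1)$ and all $\mathbf P\in\mathcal U^K$. An ex-p-merging function is an increasing Borel function $F:[0,1]^K\to[0,1]$ such that $\mathbb P(F(\mathbf P)\le\alpha)\le\alpha$ for all $\alpha\in(0,1)$ and all exchangeable $\mathbf P\in\mathcal U^K$. $F$ is symmetric if $F(\mathbf p)$ is invariant under permutations of the components of $\mathbf p$. $F$ dominates $G$ if $F(\mathbf p)\le G(\mathbf p)$ for all $\mathbf p$, strictly if moreover $F(\mathbf p)<G(\mathbf p)$ for at least one $\mathbf p$. A p-merging function is admissible if it is not strictly dominated by any p-merging function. *)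

theory Defs
  imports "HOL-Probability.Probability"
begin

definition uniform01 :: "'a measure \<Rightarrow> ('a \<Rightarrow> real) \<Rightarrow> bool" where
  "uniform01 M U \<longleftrightarrow>
     U \<in> borel_measurable M \<and> distr M borel U = uniform_measure lborel {0..1}"

definition atomless_prob_space :: "'a measure \<Rightarrow> bool" where
  "atomless_prob_space M \<longleftrightarrow> prob_space M \<and> (\<exists>U. uniform01 M U)"

definition unit_cube :: "(real ^ 'n) set" where
  "unit_cube = {p. \<forall>i. 0 \<le> p $ i \<and> p $ i \<le> 1}"

definition permute_vec :: "('n \<Rightarrow> 'n) \<Rightarrow> real ^ 'n \<Rightarrow> real ^ 'n" where
  "permute_vec \<sigma> p = (\<chi> i. p $ \<sigma> i)"

(* The random vectors take every value (not just almost every value) in the unit cube,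
   so that F (P \<omega>) is defined for an F whose domain is the cube. *)
definition uniform_vectors :: "'a measure \<Rightarrow> ('a \<Rightarrow> real ^ 'n) set" where
  "uniform_vectors M =
     {P. P \<in> M \<rightarrow>\<^sub>M restrict_space borel unit_cube \<and> (\<forall>i. uniform01 M (\<lambda>\<omega>. P \<omega> $ i))}"

definition exchangeable :: "'a measure \<Rightarrow> ('a \<Rightarrow> real ^ 'n) \<Rightarrow> bool" where
  "exchangeable M P \<longleftrightarrow>
     (\<forall>\<sigma>. \<sigma> permutes UNIV \<longrightarrow>
        distr M borel (\<lambda>\<omega>. permute_vec \<sigma> (P \<omega>)) = distr M borel P)"

(* A function on the cube is represented by a total function of which only the values on
   unit_cube matter; no definition below depends on the others. The order on real ^ 'n in
   mono_on is the componentwise one. *)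
definition increasing_borel :: "(real ^ 'n \<Rightarrow> real) \<Rightarrow> bool" where
  "increasing_borel F \<longleftrightarrow>
     F \<in> unit_cube \<rightarrow> {0..1} \<and>
     F \<in> borel_measurable (restrict_space borel unit_cube) \<and>
     mono_on unit_cube F"

definition p_merging :: "'a measure \<Rightarrow> (real ^ 'n \<Rightarrow> real) \<Rightarrow> bool" where
  "p_merging M F \<longleftrightarrow> increasing_borel F \<and>
     (\<forall>\<alpha>\<in>{0<..<1}. \<forall>P\<in>uniform_vectors M.
        measure M {\<omega> \<in> space M. F (P \<omega>) \<le> \<alpha>} \<le> \<alpha>)"

definition ex_p_merging :: "'a measure \<Rightarrow> (real ^ 'n \<Rightarrow> real) \<Rightarrow> bool" where
  "ex_p_merging M F \<longleftrightarrow> increasing_borel F \<and>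
     (\<forall>\<alpha>\<in>{0<..<1}. \<forall>P\<in>uniform_vectors M. exchangeable M P \<longrightarrow>
        measure M {\<omega> \<in> space M. F (P \<omega>) \<le> \<alpha>} \<le> \<alpha>)"

definition symmetric_fun :: "(real ^ 'n \<Rightarrow> real) \<Rightarrow> bool" where
  "symmetric_fun F \<longleftrightarrow>
     (\<forall>p\<in>unit_cube. \<forall>\<sigma>. \<sigma> permutes UNIV \<longrightarrow> F (permute_vec \<sigma> p) = F p)"

definition dominates :: "(real ^ 'n \<Rightarrow> real) \<Rightarrow> (real ^ 'n \<Rightarrow> real) \<Rightarrow> bool" where
  "dominates F G \<longleftrightarrow> (\<forall>p\<in>unit_cube. F p \<le> G p)"

definition strictly_dominates :: "(real ^ 'n \<Rightarrow> real) \<Rightarrow> (real ^ 'n \<Rightarrow> real) \<Rightarrow> bool" where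
  "strictly_dominates F G \<longleftrightarrow> dominates F G \<and> (\<exists>p\<in>unit_cube. F p < G p)"

definition admissible_p_merging :: "'a measure \<Rightarrow> (real ^ 'n \<Rightarrow> real) \<Rightarrow> bool" where
  "admissible_p_merging M G \<longleftrightarrow>
     p_merging M G \<and> \<not> (\<exists>H. p_merging M H \<and> strictly_dominates H G)"

end

theory Submission imports Defs begin

text \<open>Averaging the law of \<open>P\<close> over all permutations of the coordinates gives an exchangeable law
  with the same uniform marginals, and it gives every permutation-invariant event, in particular
  \<open>F \<le> \<alpha>\<close> for symmetric \<open>F\<close>, the same probability. The given space carries a vector with this
  law: the cube embeds in the real line with a measurable left inverse (interleave binary digits),
  and a law on the line is the image of a uniform variable under its quantile function. No variable
  independent of \<open>P\<close> is needed, which matters because \<open>P\<close> may generate the whole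
  sigma-algebra.\<close>

section \<open>Digit expansions and a measurable embedding of the cube in the line\<close>

text \<open>The partial sums are the truncations of \<open>x\<close> to \<open>n\<close> binary
  places, because integer division by 2 strips the last digit; the truncation error is at most 2^-n.
  Index 0 holds the integer part, so 1 expands as 1.000... and needs no exception.\<close>

lemma binary_expansion_sums:
  fixes x :: real
  assumes "0 \<le> x" "x \<le> 1"
  shows "(\<lambda>k. of_bool (odd \<lfloor>2 ^ k * x\<rfloor>) / 2 ^ k) sums x"
proof -
  have partial: "(\<Sum>k<Suc n. of_bool (odd \<lfloor>2 ^ k * x\<rfloor>) / 2 ^ k :: real)
      = of_int \<lfloor>2 ^ n * x\<rfloor> / 2 ^ n" for n
  proof (induction n)
    case 0
    show ?case
    proof (cases "x = 1")
      case False
      with assms have "\<lfloor>x\<rfloor> = 0" by linarith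
      then show ?thesis by simp
    qed simp
  next
    case (Suc n)
    have half: "\<lfloor>2 ^ Suc n * x\<rfloor> div 2 = \<lfloor>2 ^ n * x\<rfloor>"
      using floor_divide_real_eq_div[of 2 "2 ^ Suc n * x"] by simp
    have parity: "real_of_int a = 2 * of_int (a div 2) + of_bool (odd a)" for a :: int
      by (cases "even a") (auto elim!: evenE oddE)
    have "of_int \<lfloor>2 ^ n * x\<rfloor> / 2 ^ n + of_bool (odd a) / 2 ^ Suc n = real_of_int a / 2 ^ Suc n"
      if "a div 2 = \<lfloor>2 ^ n * x\<rfloor>" for a
      unfolding parity[of a] that by (simp add: add_divide_distrib)
    from this[OF half] show ?case
      by (simp only: sum.lessThan_Suc[of _ "Suc n"] Suc.IH)
  qed
  have "(\<lambda>n. of_int \<lfloor>2 ^ n * x\<rfloor> / 2 ^ n) \<longlonglongrightarrow> x"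
  proof (rule tendsto_sandwich)
    show "\<forall>\<^sub>F n in sequentially. x - (1/2) ^ n \<le> of_int \<lfloor>2 ^ n * x\<rfloor> / 2 ^ n"
    proof (intro always_eventually allI)
      fix n
      have "x - (1/2) ^ n = (2 ^ n * x - 1) / 2 ^ n"
        by (simp add: diff_divide_distrib power_one_over)
      also have "\<dots> \<le> of_int \<lfloor>2 ^ n * x\<rfloor> / 2 ^ n"
        by (intro divide_right_mono) (linarith, simp)
      finally show "x - (1/2) ^ n \<le> of_int \<lfloor>2 ^ n * x\<rfloor> / 2 ^ n" .
    qed
    show "\<forall>\<^sub>F n in sequentially. of_int \<lfloor>2 ^ n * x\<rfloor> / 2 ^ n \<le> x"
      by (intro always_eventually allI) (simp add: divide_le_eq mult.commute)
    have "(\<lambda>n. x - (1/2) ^ n) \<longlonglongrightarrow> x - 0"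
      by (intro tendsto_diff tendsto_const LIMSEQ_power_zero) simp
    then show "(\<lambda>n. x - (1/2) ^ n) \<longlonglongrightarrow> x" by simp
  qed simp
  then have "(\<lambda>n. \<Sum>k<Suc n. of_bool (odd \<lfloor>2 ^ k * x\<rfloor>) / 2 ^ k) \<longlonglongrightarrow> x"
    by (simp only: partial)
  then show ?thesis
    unfolding sums_def by (rule LIMSEQ_imp_Suc)
qed

text \<open>Base 4 makes the digit extraction unambiguous: with digits 0 and 1 the tail is at most 1/3,
  so it never carries.\<close>

lemma summable_base4: "summable (\<lambda>k. of_bool (b k) / 4 ^ Suc k :: real)"
proof (rule summable_comparison_test'[where g = "\<lambda>k. (1/4) ^ k" and N = 0])
  show "summable (\<lambda>k. (1/4) ^ k :: real)" by (rule summable_geometric) simp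
qed (auto simp: field_simps)

lemma base4_bounds:
  "0 \<le> (\<Sum>k. of_bool (b k) / 4 ^ Suc k :: real)" "(\<Sum>k. of_bool (b k) / 4 ^ Suc k :: real) \<le> 1 / 3"
proof -
  show "0 \<le> (\<Sum>k. of_bool (b k) / 4 ^ Suc k :: real)"
    by (intro suminf_nonneg summable_base4) simp
  have geo: "(\<lambda>k. (1/4) * (1/4) ^ k) sums (1/4 * (1 / (1 - 1/4)) :: real)"
    by (intro sums_mult geometric_sums) simp
  have "(\<Sum>k. of_bool (b k) / 4 ^ Suc k :: real) \<le> (\<Sum>k. (1/4) * (1/4) ^ k)"
    by (intro suminf_le summable_base4 sums_summable[OF geo]) (auto simp: field_simps)
  then show "(\<Sum>k. of_bool (b k) / 4 ^ Suc k :: real) \<le> 1 / 3"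
    using sums_unique[OF geo] by simp
qed

lemma base4_shift:
  "(\<Sum>k. of_bool (b k) / 4 ^ Suc k :: real)
    = (of_bool (b 0) + (\<Sum>k. of_bool (b (Suc k)) / 4 ^ Suc k)) / 4"
  using suminf_split_head[OF summable_base4[of b]]
    suminf_divide[OF summable_base4[of "b \<circ> Suc"], of 4] by (simp add: field_simps)

text \<open>Induction on the position for all digit sequences at once, with
  \<open>base4_shift\<close> peeling off the leading digit. At position 0 this digit is the integer
  part, since the tail is below 1. Later it contributes a multiple of \<open>4 ^ Suc m\<close>, an
  even integer, so the parity is that of the shifted sequence.\<close>

lemma base4_digit:
  "odd \<lfloor>4 ^ Suc m * (\<Sum>k. of_bool (b k) / 4 ^ Suc k :: real)\<rfloor> \<longleftrightarrow> b m"
proof (induction m arbitrary: b)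
  case (0 b)
  let ?t = "\<Sum>k. of_bool (b (Suc k)) / 4 ^ Suc k :: real"
  have "(\<Sum>k. of_bool (b k) / 4 ^ Suc k :: real) = (of_bool (b 0) + ?t) / 4"
    by (rule base4_shift)
  then have "4 ^ Suc 0 * (\<Sum>k. of_bool (b k) / 4 ^ Suc k :: real) = of_int (of_bool (b 0)) + ?t"
    by simp
  moreover have "\<lfloor>?t\<rfloor> = 0"
    using base4_bounds[of "\<lambda>k. b (Suc k)"] by linarith
  ultimately show ?case by (simp only: floor_add_int[symmetric] add.commute) simp
next
  case (Suc m b)
  let ?t = "\<Sum>k. of_bool (b (Suc k)) / 4 ^ Suc k :: real"
  have "(\<Sum>k. of_bool (b k) / 4 ^ Suc k :: real) = (of_bool (b 0) + ?t) / 4"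
    by (rule base4_shift)
  then have "4 ^ Suc (Suc m) * (\<Sum>k. of_bool (b k) / 4 ^ Suc k :: real)
      = 4 ^ Suc m * ?t + of_int (4 ^ Suc m * of_bool (b 0))"
    by (simp only: power_Suc of_int_mult of_int_power of_int_numeral of_int_of_bool) (simp add: algebra_simps)
  then have "\<lfloor>4 ^ Suc (Suc m) * (\<Sum>k. of_bool (b k) / 4 ^ Suc k :: real)\<rfloor>
      = \<lfloor>4 ^ Suc m * ?t\<rfloor> + 4 ^ Suc m * of_bool (b 0)"
    by (simp only: floor_add_int)
  then show ?case
    using Suc.IH[of "\<lambda>k. b (Suc k)"] by simp
qed

lemma vec_nth_measurable [measurable]: "(\<lambda>p :: real ^ 'n. p $ i) \<in> borel_measurable borel"
  by (intro borel_measurable_continuous_onI continuous_intros)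

lemma sets_unit_cube [measurable]: "(unit_cube :: (real ^ 'n) set) \<in> sets borel"
proof -
  have "(unit_cube :: (real ^ 'n) set) = cbox 0 1"
    by (auto simp: unit_cube_def mem_box_cart)
  then show ?thesis by (metis borel_closed closed_cbox)
qed

text \<open>The binary digits of all coordinates, indexed by the countable set of pairs (coordinate,
  position), are listed as one sequence and written in base 4. Reading the base-4 digits and summing
  per coordinate inverts this. Both maps are countable sums of measurable digit functions.\<close>

lemma unit_cube_embeds_in_real:
  obtains \<phi> :: "real ^ 'n \<Rightarrow> real" and \<psi> :: "real \<Rightarrow> real ^ 'n"
  where "\<phi> \<in> borel_measurable borel" "\<psi> \<in> borel_measurable borel"
    and "\<And>y. \<psi> y \<in> unit_cube" and "\<And>p. p \<in> unit_cube \<Longrightarrow> \<psi> (\<phi> p) = p"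
proof -
  \<comment> \<open>An index that codes no pair gets some arbitrary digit. This is harmless, since
    decoding reads only the indices \<open>to_nat (i, k)\<close>.\<close>
  define digit where "digit p m = (case from_nat m of (i, k) \<Rightarrow> odd \<lfloor>2 ^ k * p $ i\<rfloor>)"
    for p :: "real ^ 'n" and m :: nat
  define \<phi> where "\<phi> p = (\<Sum>m. of_bool (digit p m) / 4 ^ Suc m :: real)" for p
  \<comment> \<open>For a general \<open>y\<close> the series may reach 2, so it is clamped to keep
    \<open>\<psi>\<close> inside the cube everywhere; on codes of cube points the clamp changes
    nothing.\<close>
  define \<psi> where "\<psi> y = ((\<chi> i. max 0 (min 1
      (\<Sum>k. of_bool (odd \<lfloor>4 ^ Suc (to_nat (i, k)) * y\<rfloor>) / 2 ^ k))) :: real ^ 'n)" for y :: real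
  have odd [measurable]: "(\<lambda>x :: real. of_bool (odd \<lfloor>c * x\<rfloor>) :: real) \<in> borel_measurable borel" for c
    by measurable
  have "\<phi> \<in> borel_measurable borel"
    unfolding \<phi>_def digit_def
    by (intro borel_measurable_suminf borel_measurable_divide borel_measurable_const)
       (auto intro!: measurable_compose[OF vec_nth_measurable odd] split: prod.split)
  moreover have "\<psi> \<in> borel_measurable borel"
    by (subst borel_measurable_euclidean_space)
       (auto simp: Basis_vec_def inner_axis \<psi>_def
         intro!: borel_measurable_max borel_measurable_min borel_measurable_suminf
           borel_measurable_divide odd)
  moreover have "\<psi> y \<in> unit_cube" for y
    by (simp add: \<psi>_def unit_cube_def)
  moreover have "\<psi> (\<phi> p) = p" if "p \<in> unit_cube" for p
  proof -
    have "(\<Sum>k. of_bool (digit p (to_nat (i, k))) / 2 ^ k) = p $ i" for i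
      using binary_expansion_sums[of "p $ i"] that
      by (simp add: digit_def unit_cube_def sums_iff)
    with that show ?thesis
      unfolding \<psi>_def \<phi>_def base4_digit by (simp add: vec_eq_iff unit_cube_def)
  qed
  ultimately show ?thesis by (rule that)
qed

section \<open>Realization of prescribed laws on the given space\<close>

text \<open>Inverse transform: \<open>N.I\<close> is the generalized inverse of the distribution
  function, and \<open>N.distr_I_eq_M\<close> states that it carries Lebesgue measure on the open
  unit interval to \<open>N\<close>. What remains is to pass from the open interval to the law of
  \<open>U\<close> on the closed one.\<close>

lemma uniform01_realizes_real_distribution:
  assumes U: "uniform01 M U" and N: "real_distribution N"
  obtains X where "X \<in> borel_measurable M" "distr M borel X = N"
proof -
  interpret N: cdf_distribution N
    by (rule cdf_distribution.intro[OF N])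
  have Um [measurable]: "U \<in> borel_measurable M"
    and Ud: "distr M borel U = uniform_measure lborel {0..1}"
    using U by (auto simp: uniform01_def)
  \<comment> \<open>The value 0 outside the open interval is an arbitrary choice: \<open>U\<close>
    falls there with probability zero.\<close>
  define J where "J u = (if u \<in> {0<..<1} then N.I u else 0)" for u :: real
  have J [measurable]: "J \<in> borel_measurable borel"
    unfolding J_def
    using N.measurable_CI
    by (subst measurable_If_restrict_space_iff) (auto simp del: greaterThanLessThan_iff)
  have "distr M borel (\<lambda>\<omega>. J (U \<omega>)) = distr (uniform_measure lborel {0..1}) borel J"
    using distr_distr[of J borel borel U M] by (simp add: comp_def flip: Ud)
  also have "\<dots> = distr (restrict_space lborel {0<..<1}) borel N.I"
  proof (rule measure_eqI)
    fix A :: "real set"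
    assume "A \<in> sets (distr (uniform_measure lborel {0..1}) borel J)"
    then have A [measurable]: "A \<in> sets borel" by simp
    have JA: "J -` A \<in> sets borel"
      using measurable_sets[OF J A] by simp
    have I: "N.I \<in> restrict_space lborel {0<..<1} \<rightarrow>\<^sub>M borel"
      using N.measurable_CI by (simp cong: measurable_cong_sets restrict_space_sets_cong)
    have "emeasure (distr (uniform_measure lborel {0..1}) borel J) A
        = emeasure lborel ({0..1} \<inter> J -` A)"
      using JA by (subst emeasure_distr) (simp_all add: divide_ennreal_def)
    \<comment> \<open>The two intervals differ by two points, which are Lebesgue null.\<close>
    also have "\<dots> = emeasure lborel ({0<..<1} \<inter> J -` A)"
    proof (rule emeasure_eq_AE)
      show "AE x in lborel. x \<in> {0..1} \<inter> J -` A \<longleftrightarrow> x \<in> {0<..<1} \<inter> J -` A"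
        using AE_lborel_singleton[of 0] AE_lborel_singleton[of 1] by eventually_elim auto
    qed (use JA in auto)
    also have "{0<..<1} \<inter> J -` A = {0<..<1} \<inter> N.I -` A"
      by (auto simp: J_def)
    also have "emeasure lborel \<dots> = emeasure (distr (restrict_space lborel {0<..<1}) borel N.I) A"
      by (subst emeasure_distr[OF I])
         (auto simp: emeasure_restrict_space space_restrict_space Int_commute)
    finally show "emeasure (distr (uniform_measure lborel {0..1}) borel J) A
        = emeasure (distr (restrict_space lborel {0<..<1}) borel N.I) A" .
  qed simp
  also have "\<dots> = N" by (rule N.distr_I_eq_M)
  finally show ?thesis
    by (intro that[of "\<lambda>\<omega>. J (U \<omega>)"]) simp_all
qed

text \<open>The law is moved to the line by \<open>\<phi>\<close>, realized there, and brought back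
  by \<open>\<psi>\<close>. The round trip is the identity almost everywhere because
  \<open>Q\<close> is carried by the cube; since \<open>\<psi>\<close> always lands in the cube, the
  realization does so surely and not just almost surely.\<close>

lemma uniform01_realizes_unit_cube_distribution:
  fixes Q :: "(real ^ 'n) measure"
  assumes U: "uniform01 M U" and Q: "prob_space Q" "sets Q = sets borel" "AE p in Q. p \<in> unit_cube"
  obtains P where "P \<in> M \<rightarrow>\<^sub>M restrict_space borel unit_cube" "distr M borel P = Q"
proof -
  interpret Q: prob_space Q by fact
  obtain \<phi> :: "real ^ 'n \<Rightarrow> real" and \<psi> :: "real \<Rightarrow> real ^ 'n"
    where \<phi>: "\<phi> \<in> borel_measurable borel" and \<psi>: "\<psi> \<in> borel_measurable borel"
      and cube: "\<And>y. \<psi> y \<in> unit_cube" and inv: "\<And>p. p \<in> unit_cube \<Longrightarrow> \<psi> (\<phi> p) = p"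
    using unit_cube_embeds_in_real by blast
  have \<phi>Q: "\<phi> \<in> borel_measurable Q"
    using \<phi> Q(2) by (simp cong: measurable_cong_sets)
  obtain X where X: "X \<in> borel_measurable M" and Xd: "distr M borel X = distr Q borel \<phi>"
    using uniform01_realizes_real_distribution[OF U Q.real_distribution_distr[OF \<phi>Q]] .
  have "distr M borel (\<lambda>\<omega>. \<psi> (X \<omega>)) = distr (distr Q borel \<phi>) borel \<psi>"
    using distr_distr[OF \<psi> X] by (simp add: comp_def flip: Xd)
  also have "\<dots> = distr Q borel (\<lambda>p. \<psi> (\<phi> p))"
    using distr_distr[OF \<psi> \<phi>Q] by (simp add: comp_def)
  also have "\<dots> = distr Q borel (\<lambda>p. p)"
    using Q(3) inv \<phi>Q \<psi> Q(2)
    by (intro distr_cong_AE) (auto elim: eventually_mono cong: measurable_cong_sets)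
  also have "\<dots> = Q"
    using distr_id2[OF Q(2)[symmetric]] by simp
  finally show ?thesis
    using X \<psi> cube by (intro that[of "\<lambda>\<omega>. \<psi> (X \<omega>)"]) (auto intro!: measurable_restrict_space2)
qed

section \<open>Averaging a law over all permutations\<close>

lemma permute_vec_measurable [measurable]: "permute_vec \<sigma> \<in> borel_measurable (borel :: (real ^ 'n) measure)"
  unfolding permute_vec_def
  by (intro borel_measurable_continuous_onI continuous_intros)

lemma permute_vec_unit_cube_iff:
  assumes "\<sigma> permutes UNIV"
  shows "permute_vec \<sigma> p \<in> unit_cube \<longleftrightarrow> p \<in> unit_cube"
proof -
  have "(\<forall>i. 0 \<le> p $ \<sigma> i \<and> p $ \<sigma> i \<le> 1) \<longleftrightarrow> (\<forall>j\<in>range \<sigma>. 0 \<le> p $ j \<and> p $ j \<le> 1)"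
    by blast
  then show ?thesis
    using permutes_surj[OF assms] by (simp add: permute_vec_def unit_cube_def)
qed

text \<open>Permuting coordinates is a right action, which is why
  \<open>symmetrization_invariant\<close> composes with \<open>\<tau>\<close> on the right.\<close>

lemma permute_vec_comp: "permute_vec \<tau> (permute_vec \<sigma> p) = permute_vec (\<sigma> \<circ> \<tau>) p"
  by (simp add: permute_vec_def)

text \<open>As a monadic bind over a random permutation, the mixture inherits its basic properties
  from the general theory of probability kernels; the discrete \<open>measure_pmf\<close> makes
  measurability in \<open>\<sigma>\<close> automatic.\<close>

definition symmetrization :: "(real ^ 'n) measure \<Rightarrow> (real ^ 'n) measure" where
  "symmetrization \<mu> =
     measure_pmf (pmf_of_set {\<sigma>. \<sigma> permutes UNIV}) \<bind> (\<lambda>\<sigma>. distr \<mu> borel (permute_vec \<sigma>))"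

context
  fixes \<mu> :: "(real ^ 'n) measure"
  assumes \<mu>: "prob_space \<mu>" "sets \<mu> = sets borel"
begin

interpretation prob_space \<mu> by (rule \<mu>(1))

lemma permute_vec_measurable': "permute_vec \<sigma> \<in> borel_measurable \<mu>"
  using permute_vec_measurable \<mu>(2) by (simp cong: measurable_cong_sets)

lemma kernel_prob_algebra:
  "(\<lambda>\<sigma>. distr \<mu> borel (permute_vec \<sigma>)) \<in> measure_pmf p \<rightarrow>\<^sub>M prob_algebra borel"
  by (auto simp: measurable_def space_prob_algebra intro!: prob_space_distr permute_vec_measurable')

lemma symmetrization_prob_space: "prob_space (symmetrization \<mu>)"
  and sets_symmetrization: "sets (symmetrization \<mu>) = sets borel"
  unfolding symmetrization_def
  by (rule prob_space_bind'[OF _ kernel_prob_algebra] sets_bind'[OF _ kernel_prob_algebra];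
      simp add: space_prob_algebra measure_pmf.prob_space_axioms)+

lemma emeasure_symmetrization:
  assumes "A \<in> sets borel"
  shows "emeasure (symmetrization \<mu>) A =
    (\<integral>\<^sup>+\<sigma>. emeasure \<mu> (permute_vec \<sigma> -` A) \<partial>measure_pmf (pmf_of_set {\<sigma>. \<sigma> permutes UNIV}))"
  unfolding symmetrization_def
  using assms sets_eq_imp_space_eq[OF \<mu>(2)]
  by (subst emeasure_bind_prob_algebra[OF _ kernel_prob_algebra])
     (auto simp: space_prob_algebra measure_pmf.prob_space_axioms emeasure_distr permute_vec_measurable')

text \<open>An average of equal terms is their common value. It serves for the cube, for events
  about a single coordinate, and for the level sets of a symmetric function.\<close>

lemma emeasure_symmetrization_const:
  assumes "A \<in> sets borel" "\<And>\<sigma>. \<sigma> permutes UNIV \<Longrightarrow> emeasure \<mu> (permute_vec \<sigma> -` A) = c"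
  shows "emeasure (symmetrization \<mu>) A = c"
proof -
  have ne: "{\<sigma> :: 'n \<Rightarrow> 'n. \<sigma> permutes UNIV} \<noteq> {}" using permutes_id by blast
  have "emeasure (symmetrization \<mu>) A
      = (\<integral>\<^sup>+\<sigma>. c \<partial>measure_pmf (pmf_of_set {\<sigma> :: 'n \<Rightarrow> 'n. \<sigma> permutes UNIV}))"
    unfolding emeasure_symmetrization[OF assms(1)]
    \<comment> \<open>The hypothesis speaks of permutations alone, so the integrands are compared on
      the support of the pmf.\<close>
    by (intro nn_integral_cong_AE)
       (auto simp: AE_measure_pmf_iff set_pmf_of_set[OF ne finite_permutations] assms(2))
  then show ?thesis by simp
qed

text \<open>Translation by \<open>\<tau>\<close> is a bijection of the finite symmetric group, so it
  preserves the uniform distribution there and merely re-indexes the average.\<close>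

lemma symmetrization_invariant:
  assumes \<tau>: "\<tau> permutes UNIV"
  shows "distr (symmetrization \<mu>) borel (permute_vec \<tau>) = symmetrization \<mu>"
proof (rule measure_eqI)
  fix A :: "(real ^ 'n) set"
  assume "A \<in> sets (distr (symmetrization \<mu>) borel (permute_vec \<tau>))"
  then have A: "A \<in> sets borel" by simp
  let ?S = "{\<sigma> :: 'n \<Rightarrow> 'n. \<sigma> permutes UNIV}"
  have S: "?S \<noteq> {}" "finite ?S" using permutes_id by (blast, simp add: finite_permutations)
  have "bij_betw (\<lambda>\<sigma>. \<sigma> \<circ> \<tau>) ?S ?S"
  proof (rule bij_betwI')
    show "\<sigma> \<circ> \<tau> = \<sigma>' \<circ> \<tau> \<longleftrightarrow> \<sigma> = \<sigma>'" for \<sigma> \<sigma>' :: "'n \<Rightarrow> 'n"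
      using permutes_inverses(1)[OF \<tau>] by (metis comp_apply ext)
    show "\<sigma> \<circ> \<tau> \<in> ?S" if "\<sigma> \<in> ?S" for \<sigma>
      using that permutes_compose[OF \<tau>] by simp
    show "\<exists>\<sigma>'\<in>?S. \<sigma> = \<sigma>' \<circ> \<tau>" if "\<sigma> \<in> ?S" for \<sigma>
      using that image_compose_permutations_right[OF \<tau>] by blast
  qed
  from map_pmf_of_set_bij_betw[OF this S]
  have pmf: "pmf_of_set ?S = map_pmf (\<lambda>\<sigma>. \<sigma> \<circ> \<tau>) (pmf_of_set ?S)" by simp
  have vimage: "permute_vec \<tau> -` A \<in> sets borel"
    using measurable_sets[OF permute_vec_measurable A, of \<tau>] by simp
  have "emeasure (distr (symmetrization \<mu>) borel (permute_vec \<tau>)) A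
      = emeasure (symmetrization \<mu>) (permute_vec \<tau> -` A)"
    using A sets_symmetrization sets_eq_imp_space_eq[OF sets_symmetrization]
    by (subst emeasure_distr) (auto cong: measurable_cong_sets)
  also have "\<dots> = (\<integral>\<^sup>+\<sigma>. emeasure \<mu> (permute_vec (\<sigma> \<circ> \<tau>) -` A) \<partial>measure_pmf (pmf_of_set ?S))"
    by (subst emeasure_symmetrization[OF vimage]) (simp add: vimage_def permute_vec_comp)
  also have "\<dots> = emeasure (symmetrization \<mu>) A"
    \<comment> \<open>Only the average on the right is re-indexed; the change of variables then
      turns it into the one on the left.\<close>
    by (subst emeasure_symmetrization[OF A], subst (2) pmf) simp
  finally show "emeasure (distr (symmetrization \<mu>) borel (permute_vec \<tau>)) A
      = emeasure (symmetrization \<mu>) A" .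
qed (simp add: sets_symmetrization)

end

section \<open>Transfer from exchangeable to arbitrary uniform vectors\<close>

text \<open>Only the law of \<open>P\<close> enters: it is symmetrized, and \<open>P'\<close> is any
  realization of the result, with no pointwise relation to \<open>P\<close>. Exchangeability of
  \<open>P'\<close> is the invariance of that law.\<close>

lemma exchangeable_realization:
  fixes P :: "'a \<Rightarrow> real ^ 'n"
  assumes M: "atomless_prob_space M" and P: "P \<in> uniform_vectors M"
  obtains P' where "P' \<in> uniform_vectors M" "exchangeable M P'"
    "distr M borel P' = symmetrization (distr M borel P)"
proof -
  interpret prob_space M using M by (simp add: atomless_prob_space_def)
  obtain U where U: "uniform01 M U" using M by (auto simp: atomless_prob_space_def)
  have Pm: "P \<in> borel_measurable M" and Pc: "\<And>\<omega>. \<omega> \<in> space M \<Longrightarrow> P \<omega> \<in> unit_cube"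
    and Pu: "\<And>i. uniform01 M (\<lambda>\<omega>. P \<omega> $ i)"
    using P by (auto simp: uniform_vectors_def measurable_restrict_space2_iff)
  let ?\<mu> = "distr M borel P"
  have \<mu>: "prob_space ?\<mu>" "sets ?\<mu> = sets borel" using Pm by (auto intro: prob_space_distr)
  note sym = symmetrization_prob_space[OF \<mu>] sets_symmetrization[OF \<mu>]
  interpret Q: prob_space "symmetrization ?\<mu>" by (rule sym)
  \<comment> \<open>The cube is invariant under permutations, so every permuted law, and hence the
    mixture, gives it full mass.\<close>
  have "emeasure (symmetrization ?\<mu>) unit_cube = 1"
  proof (rule emeasure_symmetrization_const[OF \<mu> sets_unit_cube])
    fix \<sigma> :: "'n \<Rightarrow> 'n" assume \<sigma>: "\<sigma> permutes UNIV"
    have "emeasure ?\<mu> unit_cube = emeasure M (space M)"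
      using Pm Pc by (subst emeasure_distr) (auto intro!: arg_cong[where f = "emeasure M"])
    then show "emeasure ?\<mu> (permute_vec \<sigma> -` unit_cube) = 1"
      using permute_vec_unit_cube_iff[OF \<sigma>] by (simp add: vimage_def emeasure_space_1)
  qed
  then have "AE p in symmetrization ?\<mu>. p \<in> unit_cube"
    by (intro Q.AE_in_set_eq_1[THEN iffD2]) (auto simp: sym Q.emeasure_eq_measure)
  from uniform01_realizes_unit_cube_distribution[OF U sym this]
  obtain P' where P': "P' \<in> M \<rightarrow>\<^sub>M restrict_space borel unit_cube"
    and P'd: "distr M borel P' = symmetrization ?\<mu>" .
  have P'm: "P' \<in> borel_measurable M"
    using P' by (auto simp: measurable_restrict_space2_iff)
  have "uniform01 M (\<lambda>\<omega>. P' \<omega> $ i)" for i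
  proof -
    have "distr M borel (\<lambda>\<omega>. P' \<omega> $ i) = uniform_measure lborel {0..1}"
    proof (rule measure_eqI)
      fix A :: "real set"
      assume "A \<in> sets (distr M borel (\<lambda>\<omega>. P' \<omega> $ i))"
      then have A: "A \<in> sets borel" by simp
      have "emeasure (distr M borel (\<lambda>\<omega>. P' \<omega> $ i)) A
          = emeasure (symmetrization ?\<mu>) ((\<lambda>p. p $ i) -` A)"
        using A P'm measurable_sets[OF vec_nth_measurable[of i] A]
        by (simp add: P'd[symmetric] emeasure_distr vimage_comp comp_def measurable_compose[OF P'm vec_nth_measurable])
      also have "\<dots> = emeasure (uniform_measure lborel {0..1}) A"
      \<comment> \<open>Coordinate \<open>i\<close> of the permuted vector is coordinate
        \<open>\<sigma> i\<close> of \<open>P\<close>, again uniform; all terms of the average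
        agree.\<close>
      proof (rule emeasure_symmetrization_const[OF \<mu>])
        fix \<sigma> :: "'n \<Rightarrow> 'n"
        have "emeasure ?\<mu> (permute_vec \<sigma> -` (\<lambda>p. p $ i) -` A) = emeasure ?\<mu> ((\<lambda>p. p $ \<sigma> i) -` A)"
          by (simp add: vimage_def permute_vec_def)
        also have "\<dots> = emeasure (distr M borel (\<lambda>\<omega>. P \<omega> $ \<sigma> i)) A"
          using A Pm measurable_sets[OF vec_nth_measurable[of "\<sigma> i"] A]
          by (simp add: emeasure_distr vimage_comp comp_def measurable_compose[OF Pm vec_nth_measurable])
        also have "\<dots> = emeasure (uniform_measure lborel {0..1}) A"
          using Pu[of "\<sigma> i"] by (simp add: uniform01_def)
        finally show "emeasure ?\<mu> (permute_vec \<sigma> -` (\<lambda>p. p $ i) -` A)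
            = emeasure (uniform_measure lborel {0..1}) A" .
      qed (use measurable_sets[OF vec_nth_measurable A] in simp)
      finally show "emeasure (distr M borel (\<lambda>\<omega>. P' \<omega> $ i)) A
          = emeasure (uniform_measure lborel {0..1}) A" .
    qed simp
    then show ?thesis
      using measurable_compose[OF P'm vec_nth_measurable] by (simp add: uniform01_def)
  qed
  then have "P' \<in> uniform_vectors M"
    using P' by (simp add: uniform_vectors_def)
  moreover have "exchangeable M P'"
    unfolding exchangeable_def
  proof (intro allI impI)
    fix \<sigma> :: "'n \<Rightarrow> 'n" assume \<sigma>: "\<sigma> permutes UNIV"
    have "distr M borel (\<lambda>\<omega>. permute_vec \<sigma> (P' \<omega>)) = distr (distr M borel P') borel (permute_vec \<sigma>)"
      using distr_distr[OF permute_vec_measurable P'm] by (simp add: comp_def)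
    also have "\<dots> = distr M borel P'"
      unfolding P'd by (rule symmetrization_invariant[OF \<mu> \<sigma>])
    finally show "distr M borel (\<lambda>\<omega>. permute_vec \<sigma> (P' \<omega>)) = distr M borel P'" .
  qed
  ultimately show ?thesis using P'd by (rule that)
qed

text \<open>Each permutation maps the level set of \<open>F\<close> onto itself, so the law of
  \<open>P\<close> and its symmetrization give it equal mass, and the bound for \<open>P'\<close> is
  the bound for \<open>P\<close>.\<close>

lemma symmetric_ex_p_merging_imp_p_merging:
  fixes F :: "real ^ 'n \<Rightarrow> real"
  assumes M: "atomless_prob_space M" and F: "ex_p_merging M F" "symmetric_fun F"
  shows "p_merging M F"
  unfolding p_merging_def
proof (intro conjI ballI)
  show "increasing_borel F" using F by (simp add: ex_p_merging_def)
  then have Fm: "F \<in> borel_measurable (restrict_space borel unit_cube)"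
    by (simp add: increasing_borel_def)
  fix \<alpha> :: real and P :: "'a \<Rightarrow> real ^ 'n"
  assume \<alpha>: "\<alpha> \<in> {0<..<1}" and P: "P \<in> uniform_vectors M"
  interpret prob_space M using M by (simp add: atomless_prob_space_def)
  obtain P' where P': "P' \<in> uniform_vectors M" "exchangeable M P'"
    and P'd: "distr M borel P' = symmetrization (distr M borel P)"
    using exchangeable_realization[OF M P] .
  \<comment> \<open>The level set is cut down to the cube, where \<open>F\<close> is known to be
    measurable and symmetric; no probability is lost, since the vectors stay in the cube.\<close>
  define A where "A = {p \<in> unit_cube. F p \<le> \<alpha>}"
  have "{p \<in> space (restrict_space borel unit_cube). F p \<le> \<alpha>} \<in> sets (restrict_space borel unit_cube)"
    using Fm by measurable
  then have A: "A \<in> sets borel"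
    by (simp add: A_def space_restrict_space sets_restrict_space_iff)
  have level: "emeasure M {\<omega> \<in> space M. F (R \<omega>) \<le> \<alpha>} = emeasure (distr M borel R) A"
    if "R \<in> uniform_vectors M" for R :: "'a \<Rightarrow> real ^ 'n"
    using that A
    by (subst emeasure_distr)
       (auto simp: uniform_vectors_def measurable_restrict_space2_iff A_def
         intro!: arg_cong[where f = "emeasure M"])
  have Pm: "P \<in> borel_measurable M"
    using P by (auto simp: uniform_vectors_def measurable_restrict_space2_iff)
  have "emeasure (symmetrization (distr M borel P)) A = emeasure (distr M borel P) A"
  proof (rule emeasure_symmetrization_const[OF _ _ A])
    fix \<sigma> :: "'n \<Rightarrow> 'n" assume \<sigma>: "\<sigma> permutes UNIV"
    have "permute_vec \<sigma> -` A = A"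
      using F(2) \<sigma> permute_vec_unit_cube_iff[OF \<sigma>] by (auto simp: A_def symmetric_fun_def)
    then show "emeasure (distr M borel P) (permute_vec \<sigma> -` A) = emeasure (distr M borel P) A"
      by simp
  qed (use Pm in \<open>auto intro: prob_space_distr\<close>)
  then have "measure M {\<omega> \<in> space M. F (P \<omega>) \<le> \<alpha>} = measure M {\<omega> \<in> space M. F (P' \<omega>) \<le> \<alpha>}"
    using level[OF P] level[OF P'(1)] by (simp add: P'd measure_def)
  also have "\<dots> \<le> \<alpha>"
    using F(1) \<alpha> P' by (auto simp: ex_p_merging_def)
  finally show "measure M {\<omega> \<in> space M. F (P \<omega>) \<le> \<alpha>} \<le> \<alpha>" .
qed

theorem proposition3p5:
  fixes M :: "'a measure"
  assumes "atomless_prob_space M"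
    and "CARD('n::finite) \<ge> 2"
  shows "(\<forall>F :: real ^ 'n \<Rightarrow> real.
            ex_p_merging M F \<and> symmetric_fun F \<longrightarrow> p_merging M F) \<and>
         (\<forall>F G :: real ^ 'n \<Rightarrow> real.
            ex_p_merging M F \<and> admissible_p_merging M G \<and> strictly_dominates F G
              \<longrightarrow> \<not> symmetric_fun F)"
proof (intro conjI allI impI notI)
  fix F G :: "real ^ 'n \<Rightarrow> real"
  assume FG: "ex_p_merging M F \<and> admissible_p_merging M G \<and> strictly_dominates F G"
    and "symmetric_fun F"
  \<comment> \<open>A symmetric \<open>F\<close> would itself be the strictly dominating p-merging
    function that admissibility of \<open>G\<close> forbids.\<close>
  then have "p_merging M F"
    using symmetric_ex_p_merging_imp_p_merging[OF assms(1)] by blast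
  with FG show False
    unfolding admissible_p_merging_def by blast
qed (use symmetric_ex_p_merging_imp_p_merging[OF assms(1)] in blast)

end
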